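(* Given $\alpha\in(0,1)$, let $h$ be an $\alpha$ prediction smoothed autoregressive language model over a token vocabulary of size $V$, i.e. its next-token probabilities are $$p_h(x_i\mid x_{<i})=(1-\alpha)\,p_\theta(x_i\mid x_{<i})+\alpha/V,$$ where $p_\theta(x_i\mid x_{<i})\in(0,1)$ are the next-token probabilities of a base autoregressive model. Then for any given token sequence $X$, $$\mathrm{BPD}(h,X)\in\Big(\log_2(V/\alpha)-\log_2\big(1+(1-\alpha)V/\alpha\big),\ \log_2(V/\alpha)\Big),$$ and the size of this interval is $\Delta=\log_2\big(1+(1-\alpha)V/\alpha\big)$.
   Context: An autoregressive language model over a finite vocabulary of $V$ tokens assigns, to each token $x_i$ given its preceding tokens $x_{<i}=(x_1,\dots,x_{i-1})$, a conditional probability $p(x_i\mid x_{<i})$, where for each prefix $x_{<i}$ the values $p(\cdot\mid x_{<i})$ form a probability distribution on the vocabulary. The $\alpha$ prediction smoothed model mixes, at the token level, the base model's prediction $p_\theta$ with the uniform distribution on the vocabulary, with weight $\alpha$ on the uniform distribution. For a sequence $X=(x_1,\dots,x_k)$ of $k\ge 1$ tokens, the bits per dimension is $$\mathrm{BPD}(h,X)=-\frac{1}{k}\sum_{i=1}^{k}\log_2 p_h(x_i\mid x_{<i}).$$ *)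

theory Defs
  imports "HOL-Probability.Probability"
begin

text \<open>
  The vocabulary is a finite type of tokens. A model maps every prefix (possibly empty, oldest
  token first) to the distribution of the next token.
\<close>

type_synonym 'v lang_model = "'v list \<Rightarrow> 'v pmf"

definition prediction_smoothed ::
    "real \<Rightarrow> 'v::finite lang_model \<Rightarrow> 'v lang_model \<Rightarrow> bool" where
  "prediction_smoothed \<alpha> \<theta> h \<longleftrightarrow>
     (\<forall>ctx x. pmf (h ctx) x = (1 - \<alpha>) * pmf (\<theta> ctx) x + \<alpha> / real CARD('v))"

text \<open>Position \<open>i\<close> counts from 0, so the prefix of the token \<open>X ! i\<close> is \<open>take i X\<close>.\<close>

definition bpd :: "'v lang_model \<Rightarrow> 'v list \<Rightarrow> real" where
  "bpd h X = - (1 / real (length X)) * (\<Sum>i<length X. log 2 (pmf (h (take i X)) (X ! i)))"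

text \<open>The smoothing relation determines the model: it is the mixture with the uniform distribution.\<close>

lemma prediction_smoothed_mixture:
  fixes \<theta> :: "'v::finite lang_model"
  assumes "\<alpha> \<in> {0..1}"
  shows "prediction_smoothed \<alpha> \<theta> h \<longleftrightarrow>
    h = (\<lambda>ctx. bernoulli_pmf \<alpha> \<bind> (\<lambda>b. if b then pmf_of_set UNIV else \<theta> ctx))"
proof -
  have "pmf (bernoulli_pmf \<alpha> \<bind> (\<lambda>b. if b then pmf_of_set UNIV else \<theta> ctx)) x =
      (1 - \<alpha>) * pmf (\<theta> ctx) x + \<alpha> / real CARD('v)" for ctx x
    using assms by (simp add: pmf_bind)
  then show ?thesis
    by (auto simp: prediction_smoothed_def fun_eq_iff pmf_eq_iff)
qed

end

theory Submission
  imports Defs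
begin

text \<open>Mixing with the uniform distribution squeezes every next-token probability strictly
  between \<alpha>/V and 1 - \<alpha> + \<alpha>/V, because the base probability lies strictly
  between 0 and 1. Since -log 2 is strictly decreasing, each token costs strictly between -log 2 (1
  - \<alpha> + \<alpha>/V) and log 2 (V/\<alpha>) bits. BPD is the average of these costs, and an
  average of at least one number from an open interval stays in it
  (\<open>minus_average_in_greaterThanLessThan\<close>).\<close>

text \<open>The sign and the factor are placed as in the body of \<open>bpd\<close>, so that the
  lemma applies once \<open>bpd_def\<close> is unfolded. With \<open>n > 0\<close> the sums are
  nonempty, so strictness survives summation.\<close>

lemma minus_average_in_greaterThanLessThan:
  fixes f :: "nat \<Rightarrow> real"
  assumes "n > 0" and "\<And>i. i < n \<Longrightarrow> - f i \<in> {a<..<b}"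
  shows "- (1 / real n) * (\<Sum>i<n. f i) \<in> {a<..<b}"
proof -
  have "(\<Sum>i<n. a) < (\<Sum>i<n. - f i)" "(\<Sum>i<n. - f i) < (\<Sum>i<n. b)"
    by (rule sum_strict_mono; use assms in auto)+
  then show ?thesis
    using \<open>n > 0\<close> by (simp add: sum_negf field_simps)
qed

theorem theoremA2:
  fixes \<alpha> :: real
    and \<theta> h :: "'v::finite lang_model"
    and X :: "'v list"
    and V :: nat
  assumes "\<alpha> \<in> {0<..<1}"
    and "V = CARD('v)"
    and "\<And>ctx x. pmf (\<theta> ctx) x \<in> {0<..<1}"
    and "prediction_smoothed \<alpha> \<theta> h"
    and "X \<noteq> []"
  shows "bpd h X \<in> {log 2 (real V / \<alpha>) - log 2 (1 + (1 - \<alpha>) * real V / \<alpha>) <..< log 2 (real V / \<alpha>)}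
    \<and> measure lborel
           {log 2 (real V / \<alpha>) - log 2 (1 + (1 - \<alpha>) * real V / \<alpha>) <..< log 2 (real V / \<alpha>)}
         = log 2 (1 + (1 - \<alpha>) * real V / \<alpha>)"
proof -
  define \<Delta> where "\<Delta> = log 2 (1 + (1 - \<alpha>) * real V / \<alpha>)"
  have \<alpha>: "0 < \<alpha>" "\<alpha> < 1" and V: "real V > 0"
    using assms(1,2) by auto
  have gt1: "1 + (1 - \<alpha>) * real V / \<alpha> > 1"
    using \<alpha> V by simp
  \<comment> \<open>An interval with its ends in the wrong order is empty and has measure 0, so the
    length formula at the end depends on this sign.\<close>
  have "\<Delta> \<ge> 0"
    unfolding \<Delta>_def using gt1 by simp
  have upper: "log 2 (real V / \<alpha>) = - log 2 (\<alpha> / real V)"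
    using \<alpha> V by (simp add: log_divide)
  \<comment> \<open>Factoring V/\<alpha> out of the upper bound on the probability splits its
    logarithm into \<Delta> and the upper endpoint.\<close>
  have eq: "1 - \<alpha> + \<alpha> / real V = (1 + (1 - \<alpha>) * real V / \<alpha>) / (real V / \<alpha>)"
    using \<alpha> V by (simp add: field_simps)
  have "log 2 (1 - \<alpha> + \<alpha> / real V) = \<Delta> - log 2 (real V / \<alpha>)"
    unfolding eq \<Delta>_def
  proof (rule log_divide_pos)
    show "0 < 1 + (1 - \<alpha>) * real V / \<alpha>"
      using gt1 by linarith
    show "0 < real V / \<alpha>"
      using \<alpha> V by simp
  qed
  then have lower: "log 2 (real V / \<alpha>) - \<Delta> = - log 2 (1 - \<alpha> + \<alpha> / real V)"
    by simp
  have "- log 2 (pmf (h ctx) x) \<in> {log 2 (real V / \<alpha>) - \<Delta> <..< log 2 (real V / \<alpha>)}" for ctx x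
  proof -
    have p: "pmf (h ctx) x = (1 - \<alpha>) * pmf (\<theta> ctx) x + \<alpha> / real V"
      using assms(2,4) by (simp add: prediction_smoothed_def)
    have "(1 - \<alpha>) * pmf (\<theta> ctx) x \<in> {0<..<1 - \<alpha>}"
      using assms(3)[of ctx x] \<alpha> by simp
    then have "\<alpha> / real V < pmf (h ctx) x" "pmf (h ctx) x < 1 - \<alpha> + \<alpha> / real V"
      by (auto simp: p)
    \<comment> \<open>The floor due to smoothing keeps all arguments positive, where the logarithm
      is strictly increasing.\<close>
    moreover have "0 < \<alpha> / real V"
      using \<alpha> V by simp
    ultimately have "log 2 (\<alpha> / real V) < log 2 (pmf (h ctx) x)"
      "log 2 (pmf (h ctx) x) < log 2 (1 - \<alpha> + \<alpha> / real V)"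
      by (intro log_less; linarith)+
    then show ?thesis
      using lower upper by auto
  qed
  then have "bpd h X \<in> {log 2 (real V / \<alpha>) - \<Delta> <..< log 2 (real V / \<alpha>)}"
    unfolding bpd_def using \<open>X \<noteq> []\<close> by (intro minus_average_in_greaterThanLessThan) simp_all
  moreover have "measure lborel {log 2 (real V / \<alpha>) - \<Delta> <..< log 2 (real V / \<alpha>)} = \<Delta>"
    using \<open>\<Delta> \<ge> 0\<close> by simp
  ultimately show ?thesis
    unfolding \<Delta>_def by blast
qed

end
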